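(* Fix $\varepsilon\in(0,1)$. If $\mathcal A$ is an $\varepsilon$-edge differentially private mechanism that answers connected-component-count queries on graphs with $n$ vertices in the continual release model for fully dynamic streams of length $T$, such that with probability at least $0.99$ its outputs are within additive error $\zeta$, then $$\zeta=\Omega\!\left(\min\left(\sqrt{\frac n\varepsilon},\ \frac{T^{1/4}}{\varepsilon^{3/4}},\ n,\ T\right)\right).$$ Moreover, this holds even if accuracy is only required on streams in which every intermediate graph is bipartite, has maximum degree $2$, and has arboricity $2$.
   Context: A fully dynamic stream of length $T$ on a fixed vertex set of size $n$ is a sequence of updates, each an edge insertion, an edge deletion, or the empty update $\bot$. Two streams are edge-neighboring if they differ in exactly one timestep $t^*$, where one has $\bot$ and the other an edge insertion or deletion. A mechanism is $\varepsilon$-edge DP if for all edge-neighboring streams $S,S'$ and all output sets $Y$, $\Pr[\mathcal A(S)\in Y]\le e^\varepsilon\Pr[\mathcal A(S')\in Y]$. The continual release mechanism outputs an estimate after every update. Arboricity is the minimum number of forests partitioning the edge set. *)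

theory Defs
  imports "HOL-Probability.Probability"
begin

text \<open>A simple undirected graph is a vertex set together with a set of 2-element vertex sets.\<close>

definition all_edges :: "'v set \<Rightarrow> 'v set set" where
  "all_edges V = {{u, v} |u v. u \<in> V \<and> v \<in> V \<and> u \<noteq> v}"

definition adj_rel :: "'v set set \<Rightarrow> 'v rel" where
  "adj_rel E = {(u, v). u \<noteq> v \<and> {u, v} \<in> E}"

definition connected_components :: "'v set \<Rightarrow> 'v set set \<Rightarrow> 'v set set" where
  "connected_components V E = V // {(u, v) \<in> V \<times> V. (u, v) \<in> (adj_rel E)\<^sup>*}"

definition num_components :: "'v set \<Rightarrow> 'v set set \<Rightarrow> nat" where
  "num_components V E = card (connected_components V E)"

definition bipartite :: "'v set \<Rightarrow> 'v set set \<Rightarrow> bool" where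
  "bipartite V E \<longleftrightarrow>
     (\<exists>L R. L \<union> R = V \<and> L \<inter> R = {} \<and> (\<forall>e\<in>E. \<exists>u\<in>L. \<exists>v\<in>R. e = {u, v}))"

definition degree :: "'v set set \<Rightarrow> 'v \<Rightarrow> nat" where
  "degree E v = card {e \<in> E. v \<in> e}"

definition max_degree :: "'v set \<Rightarrow> 'v set set \<Rightarrow> nat" where
  "max_degree V E = (MAX v\<in>V. degree E v)"

definition is_cycle :: "'v set set \<Rightarrow> 'v list \<Rightarrow> bool" where
  "is_cycle E vs \<longleftrightarrow> 3 \<le> length vs \<and> distinct vs \<and>
     (\<forall>i<length vs. {vs ! i, vs ! (Suc i mod length vs)} \<in> E)"

definition forest :: "'v set set \<Rightarrow> bool" where
  "forest E \<longleftrightarrow> (\<nexists>vs. is_cycle E vs)"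

definition arboricity :: "'v set set \<Rightarrow> nat" where
  "arboricity E =
     (LEAST k. \<exists>P. partition_on E P \<and> finite P \<and> card P = k \<and> (\<forall>F\<in>P. forest F))"

datatype 'v update = Ins "'v set" | Del "'v set" | Bot

definition updates :: "'v set \<Rightarrow> 'v update set" where
  "updates V = insert Bot (Ins ` all_edges V \<union> Del ` all_edges V)"

definition dyn_streams :: "'v set \<Rightarrow> nat \<Rightarrow> 'v update list set" where
  "dyn_streams V T = {S. length S = T \<and> set S \<subseteq> updates V}"

text \<open>Inserting a present edge or deleting an absent one has no effect; a stream is an arbitrary
  sequence of updates, so such updates are allowed.\<close>

fun apply_update :: "'v update \<Rightarrow> 'v set set \<Rightarrow> 'v set set" where
  "apply_update (Ins e) E = insert e E"
| "apply_update (Del e) E = E - {e}"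
| "apply_update Bot E = E"

definition graph_after :: "'v update list \<Rightarrow> nat \<Rightarrow> 'v set set" where
  "graph_after S t = fold apply_update (take t S) {}"

definition edge_neighboring :: "'v update list \<Rightarrow> 'v update list \<Rightarrow> bool" where
  "edge_neighboring S S' \<longleftrightarrow> length S = length S' \<and>
     (\<exists>t<length S. (\<forall>i<length S. i \<noteq> t \<longrightarrow> S ! i = S' ! i) \<and>
        (S ! t = Bot \<and> S' ! t \<noteq> Bot \<or> S ! t \<noteq> Bot \<and> S' ! t = Bot))"

text \<open>Coordinate \<open>t < T\<close> of an output is the estimate released after update number \<open>t + 1\<close>.\<close>

definition output_space :: "nat \<Rightarrow> (nat \<Rightarrow> real) measure" where
  "output_space T = (\<Pi>\<^sub>M t\<in>{..<T}. borel)"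

text \<open>A mechanism maps each stream to the law of its output sequence. It runs online: the joint law
  of the first \<open>t\<close> outputs is determined by the first \<open>t\<close> updates.\<close>

definition continual_release_mechanism ::
    "'v set \<Rightarrow> nat \<Rightarrow> ('v update list \<Rightarrow> (nat \<Rightarrow> real) measure) \<Rightarrow> bool" where
  "continual_release_mechanism V T A \<longleftrightarrow>
     (\<forall>S\<in>dyn_streams V T. prob_space (A S) \<and> sets (A S) = sets (output_space T)) \<and>
     (\<forall>S\<in>dyn_streams V T. \<forall>S'\<in>dyn_streams V T. \<forall>t\<le>T. take t S = take t S' \<longrightarrow>
        distr (A S) (output_space t) (\<lambda>y. restrict y {..<t}) =
        distr (A S') (output_space t) (\<lambda>y. restrict y {..<t}))"

definition edge_DP ::
    "real \<Rightarrow> 'v set \<Rightarrow> nat \<Rightarrow> ('v update list \<Rightarrow> (nat \<Rightarrow> real) measure) \<Rightarrow> bool" where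
  "edge_DP \<epsilon> V T A \<longleftrightarrow>
     (\<forall>S\<in>dyn_streams V T. \<forall>S'\<in>dyn_streams V T. edge_neighboring S S' \<longrightarrow>
        (\<forall>Y\<in>sets (output_space T). measure (A S) Y \<le> exp \<epsilon> * measure (A S') Y))"

definition accurate_CC_on ::
    "'v update list set \<Rightarrow> real \<Rightarrow> 'v set \<Rightarrow> nat \<Rightarrow> ('v update list \<Rightarrow> (nat \<Rightarrow> real) measure) \<Rightarrow> bool" where
  "accurate_CC_on \<S> \<zeta> V T A \<longleftrightarrow>
     (\<forall>S\<in>\<S>. \<P>(y in A S. \<forall>t<T.
        \<bar>y t - real (num_components V (graph_after S (Suc t)))\<bar> \<le> \<zeta>) \<ge> 0.99)"

text \<open>The degree and arboricity conditions are upper bounds: every stream starts from the empty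
  graph, so no stream attains the value 2 at all times.\<close>

definition restricted_streams :: "'v set \<Rightarrow> nat \<Rightarrow> 'v update list set" where
  "restricted_streams V T = {S \<in> dyn_streams V T. \<forall>t\<le>T.
     bipartite V (graph_after S t) \<and> max_degree V (graph_after S t) \<le> 2 \<and>
     arboricity (graph_after S t) \<le> 2}"

definition CC_error_bound :: "real \<Rightarrow> nat \<Rightarrow> nat \<Rightarrow> real" where
  "CC_error_bound \<epsilon> n T =
     Min {sqrt (real n / \<epsilon>), real T powr (1/4) / \<epsilon> powr (3/4), real n, real T}"

end

theory Submission imports Defs begin

text \<open>A packing argument. Encode \<open>m = 2^k\<close> sensitive bits in \<open>m * r\<close> disjoint potential 4-cycles, each
  bit being stored in \<open>r \<le> 1 / \<epsilon>\<close> of them as the presence of one edge. Publicly toggling another edge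
  of each cycle makes the number of components equal, up to a constant, to \<open>r\<close> times the size of
  \<open>B \<inter> Q\<close>, where \<open>B\<close> is the set of bits whose edges are missing and \<open>Q\<close> is an arbitrary public set.
  Ask the \<open>2 * m\<close> queries given by the positive and negative parts of the rows of a Hadamard matrix:
  since the matrix is a multiple of an isometry, sets \<open>B\<close> and \<open>B'\<close> whose symmetric difference has more
  than \<open>m / 16\<close> elements are separated by an amount of order \<open>r * sqrt m\<close> by some query. If \<open>\<zeta>\<close> is smaller
  than that, every output sequence is accurate only for the sets of a small Hamming ball. Group
  privacy, however, gives the outputs that are accurate for \<open>B\<close> probability at least
  \<open>0.99 * exp (- card B)\<close> on the stream of the empty set, and the sum of these bounds exceeds the size
  of such a ball.\<close>

section \<open>Packing of subsets\<close>

text \<open>Exponential weighting: a counted set \<open>D\<close> satisfies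
  \<open>s ^ m \<le> (s ^ p) ^ card D\<close>, and the weights \<open>(s ^ p) ^ card D\<close> of
  all subsets add up to \<open>(1 + s ^ p) ^ m\<close>.\<close>

lemma card_sparse_subsets_le:
  fixes s :: real
  assumes s: "0 < s" "s \<le> 1"
  shows "real (card {D. D \<subseteq> {..<m} \<and> p * card D \<le> m}) \<le> ((1 + s ^ p) / s) ^ m"
proof -
  let ?F = "{D. D \<subseteq> {..<m} \<and> p * card D \<le> m}"
  have fin: "finite ?F" by (rule finite_subset[of _ "Pow {..<m}"]) auto
  have "real (card ?F) * s ^ m = (\<Sum>D\<in>?F. s ^ m)" by simp
  also have "\<dots> \<le> (\<Sum>D\<in>?F. (s ^ p) ^ card D)"
    using s by (intro sum_mono) (auto simp flip: power_mult intro: power_decreasing)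
  also have "\<dots> \<le> (\<Sum>D\<in>Pow {..<m}. (s ^ p) ^ card D)"
    using s by (intro sum_mono2) auto
  also have "\<dots> = (\<Prod>i<m. s ^ p + 1)"
    by (subst prod_add) (auto intro!: sum.cong)
  finally have "real (card ?F) * s ^ m \<le> (1 + s ^ p) ^ m" by (simp add: add.commute)
  then show ?thesis using s by (simp add: power_divide field_simps)
qed

text \<open>The sum is the expected number of events that occur, and this number is at most
  \<open>c\<close> at every outcome.\<close>

lemma (in prob_space) sum_prob_le_of_bounded_overlap:
  assumes fin: "finite I" and Ev: "\<And>i. i \<in> I \<Longrightarrow> Ev i \<in> events"
    and overlap: "\<And>y. y \<in> space M \<Longrightarrow> real (card {i \<in> I. y \<in> Ev i}) \<le> c"
  shows "(\<Sum>i\<in>I. prob (Ev i)) \<le> c"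
proof -
  have "(\<Sum>i\<in>I. prob (Ev i)) = (\<Sum>i\<in>I. \<integral>y. indicat_real (Ev i) y \<partial>M)"
    using Ev by (intro sum.cong) (auto simp: Int_absorb2 sets.sets_into_space)
  also have "\<dots> = (\<integral>y. (\<Sum>i\<in>I. indicat_real (Ev i) y) \<partial>M)"
    using Ev by (intro Bochner_Integration.integral_sum[symmetric]) (auto simp: emeasure_eq_measure)
  also have "\<dots> = (\<integral>y. real (card {i \<in> I. y \<in> Ev i}) \<partial>M)"
    using fin by (intro Bochner_Integration.integral_cong)
      (auto simp: indicator_def sum.If_cases Int_def)
  also have "\<dots> \<le> (\<integral>y. c \<partial>M)"
  proof (rule integral_mono_AE)
    have "integrable M (\<lambda>y. \<Sum>i\<in>I. indicat_real (Ev i) y)"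
      using Ev by (intro Bochner_Integration.integrable_sum) (auto simp: emeasure_eq_measure)
    also have "(\<lambda>y. \<Sum>i\<in>I. indicat_real (Ev i) y) = (\<lambda>y. real (card {i \<in> I. y \<in> Ev i}))"
      using fin by (auto simp: indicator_def sum.If_cases Int_def)
    finally show "integrable M (\<lambda>y. real (card {i \<in> I. y \<in> Ev i}))" .
  qed (use overlap in auto)
  finally show ?thesis by (simp add: prob_space)
qed

text \<open>By \<open>close\<close>, each outcome lies in \<open>Ev B\<close> only for
  \<open>B\<close> in a Hamming ball of radius \<open>m / 16\<close>, so the probabilities sum to at
  most about \<open>1.27 ^ m\<close>. By \<open>low\<close> they sum to at least
  \<open>0.99 * (1 + exp (-1)) ^ m\<close>, which is larger.\<close>

lemma (in prob_space) not_clustered_subset_events: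
  fixes \<delta> :: real
  assumes m: "1 \<le> m" and \<delta>: "\<delta> \<le> 1"
    and Ev: "\<And>B. B \<subseteq> {..<m} \<Longrightarrow> Ev B \<in> events"
    and low: "\<And>B. B \<subseteq> {..<m} \<Longrightarrow> 0.99 \<le> exp (\<delta> * card B) * prob (Ev B)"
    and close: "\<And>B B' y. B \<subseteq> {..<m} \<Longrightarrow> B' \<subseteq> {..<m} \<Longrightarrow> y \<in> Ev B \<Longrightarrow> y \<in> Ev B'
      \<Longrightarrow> 16 * card (sym_diff B B') \<le> m"
  shows False
proof -
  \<comment> \<open>The ball bound for \<open>p = 16\<close>; the choice \<open>s = 0.85\<close> is
    close to the minimiser of \<open>(1 + s ^ 16) / s\<close> and gives a value below 1.27.\<close>
  let ?c = "(1 + (85/100) ^ 16) / (85/100) :: real"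
  have "real (card {B \<in> Pow {..<m}. y \<in> Ev B}) \<le> ?c ^ m" for y
  proof (cases "{B \<in> Pow {..<m}. y \<in> Ev B} = {}")
    case True
    then show ?thesis by (simp only: card.empty) simp
  next
    case False
    then obtain B0 where B0: "B0 \<subseteq> {..<m}" "y \<in> Ev B0" by auto
    \<comment> \<open>Translating by a fixed member \<open>B0\<close> turns the family into a family
      of small sets.\<close>
    have "card {B \<in> Pow {..<m}. y \<in> Ev B} \<le> card {D. D \<subseteq> {..<m} \<and> 16 * card D \<le> m}"
    proof (rule card_inj_on_le[where f = "sym_diff B0"])
      show "inj_on (sym_diff B0) {B \<in> Pow {..<m}. y \<in> Ev B}" by (auto simp: inj_on_def)
      show "sym_diff B0 ` {B \<in> Pow {..<m}. y \<in> Ev B} \<subseteq> {D. D \<subseteq> {..<m} \<and> 16 * card D \<le> m}"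
        using B0 close[of B0 _ y] by auto
      show "finite {D. D \<subseteq> {..<m} \<and> 16 * card D \<le> m}"
        by (rule finite_subset[of _ "Pow {..<m}"]) auto
    qed
    then have "real (card {B \<in> Pow {..<m}. y \<in> Ev B})
        \<le> real (card {D. D \<subseteq> {..<m} \<and> 16 * card D \<le> m})" by simp
    also have "\<dots> \<le> ?c ^ m" by (rule card_sparse_subsets_le) auto
    finally show ?thesis .
  qed
  then have up: "(\<Sum>B\<in>Pow {..<m}. prob (Ev B)) \<le> ?c ^ m"
    by (intro sum_prob_le_of_bounded_overlap) (auto intro: Ev)
  have e1: "exp (-1) \<ge> (36/100 :: real)"
    using e_less_272 by (simp add: exp_minus field_simps)
  have ge: "0.99 * (36/100) ^ card B \<le> prob (Ev B)" if B: "B \<subseteq> {..<m}" for B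
  proof -
    have "(36/100 :: real) ^ card B \<le> exp (-1) ^ card B" using e1 by (intro power_mono) auto
    also have "\<dots> = exp (- real (card B))" by (simp flip: exp_of_nat_mult)
    also have "\<dots> \<le> exp (- (\<delta> * card B))" using \<delta> by (simp add: mult_left_le_one_le mult_right_mono[of \<delta> 1, simplified])
    finally have "0.99 * (36/100) ^ card B \<le> 0.99 * exp (- (\<delta> * card B))" by simp
    also have "\<dots> \<le> prob (Ev B)" using low[OF B] by (simp add: exp_minus field_simps)
    finally show ?thesis .
  qed
  \<comment> \<open>Expanding the product over subsets yields exactly the sum of the lower bounds
    \<open>ge\<close>.\<close>
  have "0.99 * (136/100 :: real) ^ m = 0.99 * (\<Prod>i<m. 36/100 + 1)" by simp
  also have "\<dots> = (\<Sum>B\<in>Pow {..<m}. 0.99 * (36/100) ^ card B)"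
    by (subst prod_add) (auto simp: sum_distrib_left)
  also have "\<dots> \<le> ?c ^ m" using ge by (intro order_trans[OF sum_mono up]) auto
  also have "\<dots> \<le> (127/100) ^ m" by (intro power_mono) (simp_all add: power_divide)
  also have "\<dots> = (127/136) ^ m * (136/100) ^ m" by (simp flip: power_mult_distrib)
  \<comment> \<open>Since \<open>127/136 < 0.99\<close>, a single factor already contradicts the
    lower bound; here \<open>m\<close> must be positive.\<close>
  also have "\<dots> \<le> (127/136) ^ 1 * (136/100) ^ m"
    using m by (intro mult_right_mono power_decreasing) auto
  finally show False by simp
qed

section \<open>Hadamard queries\<close>

text \<open>Sylvester's doubling: from \<open>H\<close> pass to the block matrix with rows
  \<open>(H, H)\<close> and \<open>(H, -H)\<close>. The isometry identity survives by the
  parallelogram law \<open>par\<close>.\<close>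

lemma hadamard_exists:
  "\<exists>h :: nat \<Rightarrow> nat \<Rightarrow> real. (\<forall>j i. h j i = 1 \<or> h j i = -1) \<and>
     (\<forall>z :: nat \<Rightarrow> real. (\<Sum>j<2^k. (\<Sum>i<2^k. h j i * z i)\<^sup>2) = 2^k * (\<Sum>i<2^k. (z i)\<^sup>2))"
proof (induction k)
  case 0
  show ?case by (rule exI[of _ "\<lambda>_ _. 1"]) auto
next
  case (Suc k)
  define m :: nat where "m = 2 ^ k"
  obtain h :: "nat \<Rightarrow> nat \<Rightarrow> real" where pm: "\<And>j i. h j i = 1 \<or> h j i = -1"
    and iso: "\<And>z :: nat \<Rightarrow> real. (\<Sum>j<m. (\<Sum>i<m. h j i * z i)\<^sup>2) = m * (\<Sum>i<m. (z i)\<^sup>2)"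
    using Suc.IH unfolding m_def by auto
  define h' where "h' j i = h (j mod m) (i mod m) * (if m \<le> j \<and> m \<le> i then -1 else 1)" for j i
  have split: "(\<Sum>i<2*m. f i) = (\<Sum>i<m. f i) + (\<Sum>i<m. f (m + i))" for f :: "nat \<Rightarrow> real"
  proof -
    have "(\<Sum>i<m+m. f i) = (\<Sum>i<m. f i) + (\<Sum>i=m..<m+m. f i)"
      by (simp add: lessThan_atLeast0 sum.atLeastLessThan_concat)
    also have "(\<Sum>i=m..<m+m. f i) = (\<Sum>i<m. f (m + i))"
      using sum.shift_bounds_nat_ivl[of f 0 m m] by (simp add: lessThan_atLeast0 add.commute)
    finally show ?thesis by (simp add: mult_2)
  qed
  have par: "(\<Sum>j<m. (a j + b j)\<^sup>2) + (\<Sum>j<m. (a j - b j)\<^sup>2) =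
      2 * (\<Sum>j<m. (a j)\<^sup>2) + 2 * (\<Sum>j<m. (b j)\<^sup>2)" for a b :: "nat \<Rightarrow> real"
    by (simp add: sum_distrib_left power2_eq_square algebra_simps flip: sum.distrib)
  have "(\<Sum>j<2*m. (\<Sum>i<2*m. h' j i * z i)\<^sup>2) = 2 * m * (\<Sum>i<2*m. (z i)\<^sup>2)" for z :: "nat \<Rightarrow> real"
  proof -
    let ?a = "\<lambda>j. \<Sum>i<m. h j i * z i" and ?b = "\<lambda>j. \<Sum>i<m. h j i * z (m + i)"
    have lo: "(\<Sum>i<2*m. h' j i * z i) = ?a j + ?b j" if "j < m" for j
      using that by (simp add: split h'_def)
    have hi: "(\<Sum>i<2*m. h' (m + j) i * z i) = ?a j - ?b j" if "j < m" for j
      using that by (simp add: split h'_def sum_negf)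
    have "(\<Sum>j<2*m. (\<Sum>i<2*m. h' j i * z i)\<^sup>2)
        = (\<Sum>j<m. (?a j + ?b j)\<^sup>2) + (\<Sum>j<m. (?a j - ?b j)\<^sup>2)"
      by (subst split) (simp add: lo hi)
    also have "\<dots> = 2 * (\<Sum>j<m. (?a j)\<^sup>2) + 2 * (\<Sum>j<m. (?b j)\<^sup>2)"
      by (rule par)
    also have "\<dots> = 2 * m * (\<Sum>i<2*m. (z i)\<^sup>2)"
      unfolding iso split by (simp add: algebra_simps)
    finally show ?thesis .
  qed
  moreover have "h' j i = 1 \<or> h' j i = -1" for j i
    using pm[of "j mod m" "i mod m"] by (auto simp: h'_def)
  ultimately show ?case by (intro exI[of _ h']) (simp add: m_def)
qed

text \<open>A row of a Hadamard matrix is the difference of the indicators of its positive and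
  negative parts. Some row responds to \<open>z\<close> with at least the norm of \<open>z\<close>,
  and one of its two parts carries at least half of that response; squaring gives the factor
  4.\<close>

lemma distinguishing_queries_exist:
  "\<exists>Qs :: nat set list. length Qs = 2 * 2 ^ k \<and>
     (\<forall>z :: nat \<Rightarrow> real. \<exists>Q\<in>set Qs. Q \<subseteq> {..<2^k} \<and> (\<Sum>i<2^k. (z i)\<^sup>2) \<le> 4 * (\<Sum>i\<in>Q. z i)\<^sup>2)"
proof -
  define m :: nat where "m = 2 ^ k"
  obtain h :: "nat \<Rightarrow> nat \<Rightarrow> real" where pm: "\<And>j i. h j i = 1 \<or> h j i = -1"
    and iso: "\<And>z :: nat \<Rightarrow> real. (\<Sum>j<m. (\<Sum>i<m. h j i * z i)\<^sup>2) = m * (\<Sum>i<m. (z i)\<^sup>2)"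
    using hadamard_exists[of k] unfolding m_def by auto
  let ?P = "\<lambda>j. {i. i < m \<and> h j i = 1}" and ?N = "\<lambda>j. {i. i < m \<and> h j i \<noteq> 1}"
  let ?Qs = "map ?P [0..<m] @ map ?N [0..<m]"
  have "\<exists>Q\<in>set ?Qs. Q \<subseteq> {..<m} \<and> (\<Sum>i<m. (z i)\<^sup>2) \<le> 4 * (\<Sum>i\<in>Q. z i)\<^sup>2" for z :: "nat \<Rightarrow> real"
  proof -
    \<comment> \<open>Averaging: by \<open>iso\<close> the mean of the \<open>m\<close> squared
      responses equals the squared norm of \<open>z\<close>.\<close>
    have "\<exists>j<m. (\<Sum>i<m. (z i)\<^sup>2) \<le> (\<Sum>i<m. h j i * z i)\<^sup>2"
    proof (rule ccontr)
      assume "\<not> ?thesis"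
      moreover have "0 < m" by (simp add: m_def)
      ultimately have "(\<Sum>j<m. (\<Sum>i<m. h j i * z i)\<^sup>2) < (\<Sum>j<m. \<Sum>i<m. (z i)\<^sup>2)"
        by (intro sum_strict_mono) auto
      then show False by (simp add: iso)
    qed
    then obtain j where j: "j < m" "(\<Sum>i<m. (z i)\<^sup>2) \<le> (\<Sum>i<m. h j i * z i)\<^sup>2" by blast
    have "{..<m} = ?P j \<union> ?N j" by auto
    then have "(\<Sum>i<m. h j i * z i) = (\<Sum>i\<in>?P j. h j i * z i) + (\<Sum>i\<in>?N j. h j i * z i)"
      by (simp only:) (rule sum.union_disjoint, auto)
    also have "(\<Sum>i\<in>?P j. h j i * z i) = sum z (?P j)" by (intro sum.cong) auto
    also have "(\<Sum>i\<in>?N j. h j i * z i) = - sum z (?N j)"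
      using pm by (subst sum_negf[symmetric], intro sum.cong) force+
    finally have eq: "(\<Sum>i<m. h j i * z i) = sum z (?P j) - sum z (?N j)" by simp
    have "(a - b)\<^sup>2 \<le> 4 * a\<^sup>2 \<or> (a - b)\<^sup>2 \<le> 4 * b\<^sup>2" for a b :: real
    proof -
      have "(a - b)\<^sup>2 \<le> 2 * a\<^sup>2 + 2 * b\<^sup>2"
        using zero_le_power2[of "a + b"] by (simp add: power2_eq_square algebra_simps)
      then show ?thesis by linarith
    qed
    from this[of "sum z (?P j)" "sum z (?N j)"] show ?thesis
    proof
      assume "(sum z (?P j) - sum z (?N j))\<^sup>2 \<le> 4 * (sum z (?P j))\<^sup>2"
      then show ?thesis using j eq by (intro bexI[of _ "?P j"]) auto
    next
      assume "(sum z (?P j) - sum z (?N j))\<^sup>2 \<le> 4 * (sum z (?N j))\<^sup>2"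
      then show ?thesis using j eq by (intro bexI[of _ "?N j"]) auto
    qed
  qed
  then show ?thesis unfolding m_def by (intro exI[of _ ?Qs]) (auto simp: m_def)
qed

section \<open>Counting components\<close>

text \<open>Reduces counting to exhibiting a representative map: \<open>conn\<close> and
  \<open>inv\<close> make the components exactly the fibres of \<open>f\<close> on
  \<open>V\<close>.\<close>

lemma num_components_eq_card_image:
  assumes conn: "\<And>u. u \<in> V \<Longrightarrow> (u, f u) \<in> (adj_rel E)\<^sup>*"
    and inv: "\<And>u v. {u, v} \<in> E \<Longrightarrow> f u = f v"
  shows "num_components V E = card (f ` V)"
proof -
  let ?R = "{(u, v) \<in> V \<times> V. f u = f v}"
  have "sym (adj_rel E)" by (auto simp: sym_def adj_rel_def insert_commute)
  then have sym: "sym ((adj_rel E)\<^sup>*)" by (rule sym_rtrancl)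
  have const: "f u = f v" if "(u, v) \<in> (adj_rel E)\<^sup>*" for u v
    using that by induction (auto simp: adj_rel_def dest: inv)
  have "(u, v) \<in> (adj_rel E)\<^sup>* \<longleftrightarrow> f u = f v" if "u \<in> V" "v \<in> V" for u v
    using const conn[OF that(1)] conn[OF that(2)] by (metis rtrancl_trans sym symD)
  then have "{(u, v) \<in> V \<times> V. (u, v) \<in> (adj_rel E)\<^sup>*} = ?R" by auto
  moreover have "V // ?R = (\<lambda>y. {v \<in> V. f v = y}) ` (f ` V)"
  proof -
    have "?R `` {u} = {v \<in> V. f v = f u}" if "u \<in> V" for u using that by auto
    then show ?thesis by (auto simp: quotient_def)
  qed
  moreover have "inj_on (\<lambda>y. {v \<in> V. f v = y}) (f ` V)"
    by (auto simp: inj_on_def)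
  ultimately show ?thesis
    by (simp add: num_components_def connected_components_def card_image)
qed

section \<open>Restricted streams\<close>

text \<open>Every edge that an attack stream inserts lies in the union of two fixed matchings, which
  bounds degree and arboricity by 2 at all times.\<close>

definition matching :: "'v set set \<Rightarrow> bool" where
  "matching M \<longleftrightarrow> (\<forall>e\<in>M. \<forall>e'\<in>M. \<forall>v. v \<in> e \<and> v \<in> e' \<longrightarrow> e = e')"

text \<open>Here \<open>f v\<close> names the only possible edge at \<open>v\<close>, so edges are
  checked one at a time rather than in pairs.\<close>

lemma matchingI: "(\<And>e v. e \<in> M \<Longrightarrow> v \<in> e \<Longrightarrow> e = f v) \<Longrightarrow> matching M"
  unfolding matching_def by metis

text \<open>The first two edges of a cycle share \<open>vs ! 1\<close>; in a matching they coincide,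
  forcing \<open>vs ! 0 = vs ! 2\<close>.\<close>

lemma matching_imp_forest:
  assumes "matching M" "F \<subseteq> M"
  shows "forest F"
  unfolding forest_def
proof
  assume "\<exists>vs. is_cycle F vs"
  then obtain vs where len: "3 \<le> length vs" and dist: "distinct vs"
    and edge: "\<And>i. i < length vs \<Longrightarrow> {vs ! i, vs ! (Suc i mod length vs)} \<in> F"
    by (auto simp: is_cycle_def)
  have "{vs ! 0, vs ! 1} \<in> F" "{vs ! 1, vs ! 2} \<in> F"
    using edge[of 0] edge[of 1] len by (simp_all add: numeral_2_eq_2 flip: length_greater_0_conv)
  then have "{vs ! 0, vs ! 1} \<in> M" "{vs ! 1, vs ! 2} \<in> M" using assms(2) by auto
  then have "{vs ! 0, vs ! 1} = {vs ! 1, vs ! 2}"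
    using assms(1)[unfolded matching_def, rule_format, of _ _ "vs ! 1"] by simp
  then have "vs ! 0 = vs ! 2" by (auto simp: doubleton_eq_iff)
  moreover have "0 < length vs" "2 < length vs" using len by linarith+
  ultimately show False using nth_eq_iff_index_eq[OF dist, of 0 2] by simp
qed

lemma arboricity_le_2:
  assumes "matching M1" "matching M2" "E \<subseteq> M1 \<union> M2"
  shows "arboricity E \<le> 2"
proof -
  \<comment> \<open>A partition has no empty block, so \<open>{}\<close> is removed in case
    \<open>E\<close> lies within one of the two pieces.\<close>
  let ?P = "{E \<inter> M1, E - M1} - {{}}"
  have "partition_on E ?P" by (auto simp: partition_on_def disjoint_def)
  moreover have "\<forall>F\<in>?P. forest F"
    using matching_imp_forest[OF assms(1), of "E \<inter> M1"] matching_imp_forest[OF assms(2), of "E - M1"]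
      assms(3) by blast
  ultimately have "arboricity E \<le> card ?P"
    unfolding arboricity_def by (intro Least_le exI[of _ ?P]) auto
  also have "\<dots> \<le> card {E \<inter> M1, E - M1}" by (intro card_mono) auto
  also have "\<dots> \<le> 2" by (simp add: card_insert_if)
  finally show ?thesis .
qed

lemma degree_le_2:
  assumes "matching M1" "matching M2" "E \<subseteq> M1 \<union> M2"
  shows "degree E v \<le> 2"
proof -
  have one: "finite {e \<in> M. v \<in> e} \<and> card {e \<in> M. v \<in> e} \<le> 1" if "matching M" for M
  proof (cases "{e \<in> M. v \<in> e} = {}")
    case False
    then obtain e where "e \<in> M" "v \<in> e" by auto
    then have "{e \<in> M. v \<in> e} = {e}" using that unfolding matching_def by blast
    then show ?thesis by simp
  qed (simp only: card.empty, simp)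
  have "degree E v \<le> card ({e \<in> M1. v \<in> e} \<union> {e \<in> M2. v \<in> e})"
    unfolding degree_def using assms one[of M1] one[of M2] by (intro card_mono) auto
  also have "\<dots> \<le> card {e \<in> M1. v \<in> e} + card {e \<in> M2. v \<in> e}" by (rule card_Un_le)
  also have "\<dots> \<le> 2" using one[OF assms(1)] one[OF assms(2)] by simp
  finally show ?thesis .
qed

lemma fold_apply_update_subset: "fold apply_update S E \<subseteq> E \<union> {e. Ins e \<in> set S}"
proof (induction S arbitrary: E)
  case (Cons u S)
  from Cons[of "apply_update u E"] show ?case by (cases u) auto
qed auto

text \<open>An edge is present only if it was inserted, so conditions on the set of inserted edges
  control every intermediate graph.\<close>

lemma restricted_streamsI:
  assumes S: "S \<in> dyn_streams V T" and V: "finite V" "V \<noteq> {}"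
    and M: "matching M1" "matching M2" and ins: "{e. Ins e \<in> set S} \<subseteq> M1 \<union> M2"
    and LR: "L \<union> R = V" "L \<inter> R = {}" "\<And>e. e \<in> M1 \<union> M2 \<Longrightarrow> \<exists>u\<in>L. \<exists>v\<in>R. e = {u, v}"
  shows "S \<in> restricted_streams V T"
proof -
  have sub: "graph_after S t \<subseteq> M1 \<union> M2" for t
  proof -
    have "graph_after S t \<subseteq> {e. Ins e \<in> set (take t S)}"
      using fold_apply_update_subset[of "take t S" "{}"] by (simp add: graph_after_def)
    also have "\<dots> \<subseteq> {e. Ins e \<in> set S}" using set_take_subset[of t S] by blast
    finally show ?thesis using ins by blast
  qed
  have "bipartite V (graph_after S t)" for t
    unfolding bipartite_def
  proof (intro exI conjI ballI)
    show "\<exists>u\<in>L. \<exists>v\<in>R. e = {u, v}" if "e \<in> graph_after S t" for e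
      using LR(3) sub[of t] that by blast
  qed (fact LR)+
  moreover have "max_degree V (graph_after S t) \<le> 2" for t
    unfolding max_degree_def using V degree_le_2[OF M sub] by (subst Max_le_iff) auto
  ultimately show ?thesis
    using S arboricity_le_2[OF M sub] by (auto simp: restricted_streams_def)
qed

section \<open>Effect of blocks of updates\<close>

lemma fold_insertions:
  "fold apply_update (map (\<lambda>g. if P g then Bot else Ins (e g)) gs) E = E \<union> e ` {g \<in> set gs. \<not> P g}"
  by (induction gs arbitrary: E) auto

text \<open>Ineffective updates are legal, so the block sets every edge \<open>e g\<close> to a
  prescribed state whatever its state was before. Injectivity keeps different indices from
  overwriting each other.\<close>

lemma fold_toggles:
  assumes "inj e"
  shows "fold apply_update (map (\<lambda>g. if P g then Del (e g) else Ins (e g)) gs) E =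
    (E - e ` set gs) \<union> e ` {g \<in> set gs. \<not> P g}"
proof (induction gs arbitrary: E)
  case (Cons g gs)
  then show ?case using assms by (auto simp: inj_eq)
qed auto

section \<open>Privacy and accuracy\<close>

text \<open>A hybrid argument: the differing positions of \<open>S\<close> are replaced one by one
  by those of \<open>S'\<close>. By \<open>diff\<close> one of the two entries is
  \<open>Bot\<close>, so each replacement is an edge-neighboring step and costs a factor
  \<open>exp \<epsilon>\<close>.\<close>

lemma group_privacy:
  assumes DP: "edge_DP \<epsilon> V T A" and Y: "Y \<in> sets (output_space T)"
    and S: "S \<in> dyn_streams V T" and S': "S' \<in> dyn_streams V T"
    and diff: "\<And>i. i < T \<Longrightarrow> S ! i \<noteq> S' ! i \<Longrightarrow> S ! i = Bot \<or> S' ! i = Bot"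
  shows "measure (A S) Y \<le> exp (\<epsilon> * card {i. i < T \<and> S ! i \<noteq> S' ! i}) * measure (A S') Y"
  using S diff
proof (induction "card {i. i < T \<and> S ! i \<noteq> S' ! i}" arbitrary: S)
  case 0
  then have "S = S'" using S' by (intro nth_equalityI) (auto simp: dyn_streams_def)
  then show ?case by simp
next
  case (Suc k)
  then have "{i. i < T \<and> S ! i \<noteq> S' ! i} \<noteq> {}" by (metis card.empty nat.distinct(1))
  then obtain j where j: "j < T" "S ! j \<noteq> S' ! j" by auto
  have len: "length S = T" "length S' = T" using Suc.prems S' by (auto simp: dyn_streams_def)
  let ?U = "S[j := S' ! j]"
  have U: "?U \<in> dyn_streams V T"
  proof -
    have "S' ! j \<in> updates V" using S' j len by (metis (mono_tags, lifting) dyn_streams_def mem_Collect_eq nth_mem subsetD)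
    then have "set ?U \<subseteq> updates V"
      using Suc.prems(1) set_update_subset_insert[of S j "S' ! j"] by (auto simp: dyn_streams_def)
    then show ?thesis using len by (simp add: dyn_streams_def)
  qed
  have nthU: "?U ! i = (if i = j then S' ! j else S ! i)" for i using j len by simp
  have "{i. i < T \<and> ?U ! i \<noteq> S' ! i} = {i. i < T \<and> S ! i \<noteq> S' ! i} - {j}"
    using nthU by (auto split: if_splits)
  then have k: "k = card {i. i < T \<and> ?U ! i \<noteq> S' ! i}"
    using Suc.hyps(2) j by (simp add: card_Diff_singleton_if)
  have "edge_neighboring S ?U"
    unfolding edge_neighboring_def using len j Suc.prems(2)[OF j]
    by (intro conjI exI[of _ j]) (auto simp: nthU)
  then have "measure (A S) Y \<le> exp \<epsilon> * measure (A ?U) Y"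
    using DP Suc.prems U Y by (auto simp: edge_DP_def)
  also have "measure (A ?U) Y \<le> exp (\<epsilon> * k) * measure (A S') Y"
    unfolding k
  proof (rule Suc.hyps(1)[OF k U])
    fix i assume "i < T" "?U ! i \<noteq> S' ! i"
    then show "?U ! i = Bot \<or> S' ! i = Bot"
      using Suc.prems(2)[of i] nthU by (auto split: if_splits)
  qed
  finally show ?case
    unfolding Suc.hyps(2)[symmetric] by (simp add: algebra_simps exp_add)
qed

text \<open>Formed in the common output space, so that the event belonging to one stream can be
  measured under the law of another.\<close>

definition accurate_outputs :: "'v set \<Rightarrow> nat \<Rightarrow> real \<Rightarrow> 'v update list \<Rightarrow> (nat \<Rightarrow> real) set" where
  "accurate_outputs V T \<zeta> S = {y \<in> space (output_space T). \<forall>t<T.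
     \<bar>y t - real (num_components V (graph_after S (Suc t)))\<bar> \<le> \<zeta>}"

lemma accurate_outputs_measurable: "accurate_outputs V T \<zeta> S \<in> sets (output_space T)"
proof -
  have "{y \<in> space (output_space T). \<forall>t\<in>{..<T}.
     \<bar>y t - real (num_components V (graph_after S (Suc t)))\<bar> \<le> \<zeta>} \<in> sets (output_space T)"
    unfolding output_space_def by measurable
  then show ?thesis by (simp only: accurate_outputs_def Ball_def lessThan_iff)
qed

lemma measure_accurate_outputs:
  assumes "continual_release_mechanism V T A" "accurate_CC_on \<S> \<zeta> V T A"
    and "S \<in> \<S>" "S \<in> dyn_streams V T"
  shows "0.99 \<le> measure (A S) (accurate_outputs V T \<zeta> S)"
proof -
  have "sets (A S) = sets (output_space T)"
    using assms by (auto simp: continual_release_mechanism_def)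
  then have "space (A S) = space (output_space T)" by (rule sets_eq_imp_space_eq)
  then show ?thesis using assms by (auto simp: accurate_CC_on_def accurate_outputs_def)
qed

section \<open>The attack streams\<close>

text \<open>Division by \<open>r\<close> cuts the gadget indices into disjoint blocks of length
  \<open>r\<close>, one per bit.\<close>

lemma card_div_mem:
  fixes r m :: nat
  assumes r: "1 \<le> r" and X: "X \<subseteq> {..<m}"
  shows "card {g. g < m * r \<and> g div r \<in> X} = r * card X"
proof -
  have fin: "finite X" using X finite_subset by blast
  have div: "g div r = i \<longleftrightarrow> g \<in> {i * r..<i * r + r}" for g i
    using r dividend_less_times_div[of r g] by (auto simp: div_nat_eqI mult.commute)
  have "{g. g < m * r \<and> g div r \<in> X} = (\<Union>i\<in>X. {i * r..<i * r + r})"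
  proof (intro set_eqI iffI)
    fix g assume "g \<in> (\<Union>i\<in>X. {i * r..<i * r + r})"
    then obtain i where i: "i \<in> X" "g div r = i" using div by auto
    then show "g \<in> {g. g < m * r \<and> g div r \<in> X}"
      using X r by (auto simp: less_mult_imp_div_less div_less_iff_less_mult)
  qed (use div in auto)
  moreover have "card (\<Union>i\<in>X. {i * r..<i * r + r}) = (\<Sum>i\<in>X. card {i * r..<i * r + r})"
  proof (rule card_UN_disjoint)
    show "\<forall>i\<in>X. \<forall>j\<in>X. i \<noteq> j \<longrightarrow> {i * r..<i * r + r} \<inter> {j * r..<j * r + r} = {}"
    proof -
      have ivl: "{i * r..<i * r + r} = {g. g div r = i}" for i using div by blast
      show ?thesis unfolding ivl by blast
    qed
  qed (use fin in auto)
  ultimately show ?thesis by (simp add: mult.commute)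
qed

text \<open>Gadget \<open>g\<close> lives on the vertices \<open>4g, \<dots>, 4g + 3\<close>. Its private edge and its query edge are the
  two edges at \<open>4g + 3\<close>, so that vertex is isolated iff both are missing, and otherwise the gadget
  is connected. Sensitive bit \<open>i\<close> is stored in the \<open>r\<close> gadgets \<open>g\<close> with \<open>g div r = i\<close>.\<close>

definition private_edge :: "nat \<Rightarrow> nat set" where "private_edge g = {4 * g, 4 * g + 3}"
definition left_edge :: "nat \<Rightarrow> nat set" where "left_edge g = {4 * g, 4 * g + 1}"
definition middle_edge :: "nat \<Rightarrow> nat set" where "middle_edge g = {4 * g + 1, 4 * g + 2}"
definition query_edge :: "nat \<Rightarrow> nat set" where "query_edge g = {4 * g + 2, 4 * g + 3}"

lemmas gadget_edge_defs = private_edge_def left_edge_def middle_edge_def query_edge_def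

lemma inj_query_edge: "inj query_edge"
  by (auto simp: inj_def query_edge_def doubleton_eq_iff)

lemma query_edge_neq:
  "private_edge g \<noteq> query_edge g'" "left_edge g \<noteq> query_edge g'" "middle_edge g \<noteq> query_edge g'"
  unfolding gadget_edge_defs doubleton_eq_iff by presburger+

text \<open>Both \<open>B\<close> and \<open>Q\<close> are encoded by absent edges, so isolation of
  \<open>4g + 3\<close> computes a conjunction.\<close>

definition gadget_graph :: "nat \<Rightarrow> nat \<Rightarrow> nat set \<Rightarrow> nat set \<Rightarrow> nat set set" where
  "gadget_graph G r B Q = private_edge ` {g. g < G \<and> g div r \<notin> B} \<union> left_edge ` {..<G} \<union>
     middle_edge ` {..<G} \<union> query_edge ` {g. g < G \<and> g div r \<notin> Q}"

text \<open>The first summand counts one component per gadget and one per vertex outside all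
  gadgets. It depends on neither \<open>B\<close> nor \<open>Q\<close> and cancels when two sets are
  compared.\<close>

lemma num_components_gadget_graph:
  assumes n: "4 * G \<le> n"
  shows "num_components {..<n} (gadget_graph G r B Q) =
    card {v. v < n \<and> (4 * G \<le> v \<or> v mod 4 = 0)} + card {g. g < G \<and> g div r \<in> B \<inter> Q}"
proof -
  let ?E = "gadget_graph G r B Q" and ?X = "{g. g < G \<and> g div r \<in> B \<inter> Q}"
  \<comment> \<open>The representative map: a gadget vertex goes to its base \<open>4g\<close>,
    except an isolated \<open>4g + 3\<close>, which represents itself like the vertices outside the
    gadgets.\<close>
  define f where "f v = (if v < 4 * G \<and> \<not> (v mod 4 = 3 \<and> v div 4 div r \<in> B \<inter> Q)
    then 4 * (v div 4) else v)" for v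
  have val: "f (4 * g) = 4 * g" "f (4 * g + 1) = 4 * g" "f (4 * g + 2) = 4 * g"
    "f (4 * g + 3) = (if g div r \<in> B \<inter> Q then 4 * g + 3 else 4 * g)" if "g < G" for g
  proof -
    have "(4 * g + 1) div 4 = g" "(4 * g + 2) div 4 = g" "(4 * g + 3) div 4 = g"
      "(4 * g + 1) mod 4 = 1" "(4 * g + 2) mod 4 = 2" "(4 * g + 3) mod 4 = 3" by presburger+
    then show "f (4 * g) = 4 * g" "f (4 * g + 1) = 4 * g" "f (4 * g + 2) = 4 * g"
      "f (4 * g + 3) = (if g div r \<in> B \<inter> Q then 4 * g + 3 else 4 * g)"
      using that unfolding f_def by auto
  qed
  have vertex: "4 * G \<le> v \<or> (\<exists>g<G. v = 4 * g \<or> v = 4 * g + 1 \<or> v = 4 * g + 2 \<or> v = 4 * g + 3)"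
    for v by presburger
  have "num_components {..<n} ?E = card (f ` {..<n})"
  proof (rule num_components_eq_card_image)
    fix u v assume "{u, v} \<in> ?E"
    then consider g where "g < G" "{u, v} = private_edge g" "g div r \<notin> B"
      | g where "g < G" "{u, v} = left_edge g" | g where "g < G" "{u, v} = middle_edge g"
      | g where "g < G" "{u, v} = query_edge g" "g div r \<notin> Q"
      unfolding gadget_graph_def by blast
    then show "f u = f v"
      by cases (auto simp: gadget_edge_defs doubleton_eq_iff val val[simplified])
  next
    fix v
    let ?R = "(adj_rel ?E)\<^sup>*"
    show "(v, f v) \<in> ?R"
    proof (cases "4 * G \<le> v")
      case True
      then show ?thesis by (simp add: f_def)
    next
      case False
      then obtain g where g: "g < G" "v = 4 * g \<or> v = 4 * g + 1 \<or> v = 4 * g + 2 \<or> v = 4 * g + 3"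
        using vertex by (meson not_le)
      have adj: "(u, w) \<in> adj_rel ?E" if "{u, w} \<in> ?E" "u \<noteq> w" for u w
        using that by (simp add: adj_rel_def)
      have 1: "(4 * g + 1, 4 * g) \<in> ?R"
        using g by (intro r_into_rtrancl adj) (auto simp: gadget_graph_def left_edge_def insert_commute)
      have "(4 * g + 2, 4 * g + 1) \<in> adj_rel ?E"
        using g by (intro adj) (auto simp: gadget_graph_def middle_edge_def insert_commute)
      then have 2: "(4 * g + 2, 4 * g) \<in> ?R" using 1 by (rule converse_rtrancl_into_rtrancl)
      \<comment> \<open>Either the private edge leads directly to \<open>4g\<close>, or the bit is
        in \<open>B\<close>, hence not in \<open>Q\<close>, and the query edge leads onto the
        path.\<close>
      have 3: "(4 * g + 3, 4 * g) \<in> ?R" if "g div r \<notin> B \<inter> Q"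
      proof (cases "g div r \<in> B")
        case True
        then have "(4 * g + 3, 4 * g + 2) \<in> adj_rel ?E"
          using g that by (intro adj) (auto simp: gadget_graph_def query_edge_def insert_commute)
        then show ?thesis using 2 by (rule converse_rtrancl_into_rtrancl)
      next
        case False
        then show ?thesis using g
          by (intro r_into_rtrancl adj) (auto simp: gadget_graph_def private_edge_def insert_commute)
      qed
      from g(2) show ?thesis using 1 2 3 val[OF g(1)] by (elim disjE) simp_all
    qed
  qed
  also have "f ` {..<n} = {v. v < n \<and> (4 * G \<le> v \<or> v mod 4 = 0)} \<union> (\<lambda>g. 4 * g + 3) ` ?X"
  proof (intro set_eqI iffI)
    fix w assume "w \<in> f ` {..<n}"
    then obtain v where v: "v < n" "w = f v" by auto
    show "w \<in> {v. v < n \<and> (4 * G \<le> v \<or> v mod 4 = 0)} \<union> (\<lambda>g. 4 * g + 3) ` ?X"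
    proof (cases "4 * G \<le> v")
      case True
      then show ?thesis using v by (simp add: f_def)
    next
      case False
      then obtain g where g: "g < G" "v = 4 * g \<or> v = 4 * g + 1 \<or> v = 4 * g + 2 \<or> v = 4 * g + 3"
        using vertex by (meson not_le)
      then have "w = 4 * g \<or> w = 4 * g + 3 \<and> g \<in> ?X" using v val[OF g(1)] by (auto split: if_splits)
      then show ?thesis using g n by auto
    qed
  next
    fix w assume "w \<in> {v. v < n \<and> (4 * G \<le> v \<or> v mod 4 = 0)} \<union> (\<lambda>g. 4 * g + 3) ` ?X"
    then have "w < n" "f w = w" using n val(4) by (auto simp: f_def)
    then show "w \<in> f ` {..<n}" by (metis image_eqI lessThan_iff)
  qed
  also have "card \<dots> = card {v. v < n \<and> (4 * G \<le> v \<or> v mod 4 = 0)} + card ((\<lambda>g. 4 * g + 3) ` ?X)"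
    by (rule card_Un_disjoint) (auto, presburger)
  also have "card ((\<lambda>g. 4 * g + 3) ` ?X) = card ?X"
    by (intro card_image) (auto simp: inj_on_def)
  finally show ?thesis .
qed

section \<open>Phases of the attack stream\<close>

definition load_phase :: "nat \<Rightarrow> nat \<Rightarrow> nat set \<Rightarrow> nat update list" where
  "load_phase G r B = map (\<lambda>g. if g div r \<in> B then Bot else Ins (private_edge g)) [0..<G]"

definition path_phase :: "nat \<Rightarrow> nat update list" where
  "path_phase G = map (\<lambda>g. Ins (left_edge g)) [0..<G] @ map (\<lambda>g. Ins (middle_edge g)) [0..<G]"

definition query_phase :: "nat \<Rightarrow> nat \<Rightarrow> nat set \<Rightarrow> nat update list" where
  "query_phase G r Q =
     map (\<lambda>g. if g div r \<in> Q then Del (query_edge g) else Ins (query_edge g)) [0..<G]"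

definition public_phase :: "nat \<Rightarrow> nat \<Rightarrow> nat set list \<Rightarrow> nat update list" where
  "public_phase G r Qs = path_phase G @ concat (map (query_phase G r) Qs)"

text \<open>Only the load phase depends on \<open>B\<close>. The padding gives length
  \<open>T\<close> provided the other phases fit, since the subtraction is truncated.\<close>

definition attack_stream :: "nat \<Rightarrow> nat \<Rightarrow> nat \<Rightarrow> nat set list \<Rightarrow> nat set \<Rightarrow> nat update list" where
  "attack_stream T G r Qs B = load_phase G r B @ public_phase G r Qs @
     replicate (T - (3 * G + length Qs * G)) Bot"

lemma length_load_phase: "length (load_phase G r B) = G"
  by (simp add: load_phase_def)

lemma length_public_phase: "length (public_phase G r Qs) = 2 * G + length Qs * G"
  by (induction Qs) (auto simp: public_phase_def path_phase_def query_phase_def)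

lemma length_attack_stream:
  "3 * G + length Qs * G \<le> T \<Longrightarrow> length (attack_stream T G r Qs B) = T"
  by (simp add: attack_stream_def length_load_phase length_public_phase)

text \<open>The two matchings are the pairs of opposite edges of the 4-cycles, and vertex parity is
  the bipartition. The residue of a vertex modulo 4 determines its edge in each matching.\<close>

lemma attack_stream_in_restricted_streams:
  assumes n: "4 * G \<le> n" "1 \<le> n" and T: "3 * G + length Qs * G \<le> T"
  shows "attack_stream T G r Qs B \<in> restricted_streams {..<n} T"
proof (rule restricted_streamsI)
  let ?M1 = "(private_edge ` {..<G} \<union> middle_edge ` {..<G})"
    and ?M2 = "(left_edge ` {..<G} \<union> query_edge ` {..<G})"
  have set: "set (attack_stream T G r Qs B) \<subseteq> insert Bot (Ins ` (?M1 \<union> ?M2) \<union> Del ` (?M1 \<union> ?M2))"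
    by (auto simp: attack_stream_def load_phase_def public_phase_def path_phase_def query_phase_def)
  then show "{e. Ins e \<in> set (attack_stream T G r Qs B)} \<subseteq> ?M1 \<union> ?M2" by auto
  have sub: "?M1 \<union> ?M2 \<subseteq> all_edges {..<n}"
    using n by (fastforce simp: all_edges_def gadget_edge_defs)
  have "insert Bot (Ins ` X \<union> Del ` X) \<subseteq> updates {..<n}" if "X \<subseteq> all_edges {..<n}" for X
    using that by (auto simp: updates_def)
  then have "set (attack_stream T G r Qs B) \<subseteq> updates {..<n}" by (rule order_trans[OF set]) (rule sub)
  then show "attack_stream T G r Qs B \<in> dyn_streams {..<n} T"
    using length_attack_stream[OF T] by (simp add: dyn_streams_def)
  have div: "(4 * g + 1) div 4 = g" "(4 * g + 2) div 4 = g" "(4 * g + 3) div 4 = g" for g :: nat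
    by presburger+
  have mod: "(4 * g + 1) mod 4 = 1" "(4 * g + 2) mod 4 = 2" "(4 * g + 3) mod 4 = 3" for g :: nat
    by presburger+
  show "matching ?M1"
    by (rule matchingI[where f = "\<lambda>v. if v mod 4 = 1 \<or> v mod 4 = 2
        then middle_edge (v div 4) else private_edge (v div 4)"])
      (auto simp: private_edge_def middle_edge_def div mod simp del: One_nat_def add_Suc_right add_2_eq_Suc')
  show "matching ?M2"
    by (rule matchingI[where f = "\<lambda>v. if v mod 4 < 2
        then left_edge (v div 4) else query_edge (v div 4)"])
      (auto simp: left_edge_def query_edge_def div mod simp del: One_nat_def add_Suc_right add_2_eq_Suc')
  show "{v. v < n \<and> even v} \<union> {v. v < n \<and> odd v} = {..<n}"
    "{v. v < n \<and> even v} \<inter> {v. v < n \<and> odd v} = {}" by auto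
  show "\<exists>u\<in>{v. v < n \<and> even v}. \<exists>v\<in>{v. v < n \<and> odd v}. e = {u, v}" if e: "e \<in> ?M1 \<union> ?M2" for e
  proof -
    obtain g where g: "g < G" "e \<in> {private_edge g, middle_edge g, left_edge g, query_edge g}"
      using e by blast
    have lt: "4 * g + 3 < n" using g n by simp
    have *: ?thesis if "e = {u, v}" "even u" "odd v" "u < n" "v < n" for u v
      using that by blast
    show ?thesis
      using g(2) lt *[of "4 * g" "4 * g + 3"] *[of "4 * g + 2" "4 * g + 1"]
        *[of "4 * g" "4 * g + 1"] *[of "4 * g + 2" "4 * g + 3"]
      by (auto simp: gadget_edge_defs insert_commute)
  qed
qed (use n in \<open>auto simp: lessThan_empty_iff\<close>)

text \<open>Traces of earlier queries are confined to the query edges, all of which the next query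
  phase overwrites.\<close>

lemma fold_query_phases:
  "fold apply_update (concat (map (query_phase G r) Qs)) E - query_edge ` {..<G} =
    E - query_edge ` {..<G}"
proof (induction Qs arbitrary: E)
  case (Cons Q Qs)
  have "fold apply_update (query_phase G r Q) E - query_edge ` {..<G} = E - query_edge ` {..<G}"
    unfolding query_phase_def fold_toggles[OF inj_query_edge] by auto
  then show ?case by (simp add: Cons)
qed simp

text \<open>The time is the end of the phase for \<open>Q\<close>. It is chosen before
  \<open>B\<close>, so one output coordinate serves to compare different sets.\<close>

lemma attack_stream_answers_query:
  assumes Q: "Q \<in> set Qs" and G: "1 \<le> G" and T: "3 * G + length Qs * G \<le> T"
  shows "\<exists>t<T. \<forall>B. graph_after (attack_stream T G r Qs B) (Suc t) = gadget_graph G r B Q"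
proof -
  obtain Qs1 Qs2 where Qs: "Qs = Qs1 @ Q # Qs2" using Q by (meson split_list)
  \<comment> \<open>Load phase, then paths and earlier queries, then the phase of \<open>Q\<close>
    itself. The answer after \<open>l\<close> updates is output coordinate
    \<open>l - 1\<close>.\<close>
  define l where "l = G + (2 * G + length Qs1 * G) + G"
  have lT: "1 \<le> l" "l \<le> T" using T G unfolding l_def Qs by (auto simp: algebra_simps)
  have "graph_after (attack_stream T G r Qs B) l = gadget_graph G r B Q" for B
  proof -
    have split: "attack_stream T G r Qs B =
        (load_phase G r B @ public_phase G r Qs1 @ query_phase G r Q) @
        concat (map (query_phase G r) Qs2) @ replicate (T - (3 * G + length Qs * G)) Bot"
      by (simp add: attack_stream_def public_phase_def Qs)
    have len: "l = length (load_phase G r B @ public_phase G r Qs1 @ query_phase G r Q)"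
      by (simp add: l_def length_load_phase length_public_phase query_phase_def)
    have take: "take l (attack_stream T G r Qs B) =
        load_phase G r B @ public_phase G r Qs1 @ query_phase G r Q"
      unfolding split len by simp
    let ?E0 = "private_edge ` {g. g < G \<and> g div r \<notin> B} \<union> left_edge ` {..<G} \<union> middle_edge ` {..<G}"
    have ins: "fold apply_update (map (\<lambda>g. Ins (e g)) gs) E = E \<union> e ` set gs" for e gs and E :: "nat set set"
      using fold_insertions[of "\<lambda>_. False" e gs E] by simp
    have "fold apply_update (load_phase G r B @ path_phase G) {} = ?E0"
      by (simp add: load_phase_def path_phase_def fold_insertions ins lessThan_atLeast0)
    then have "graph_after (attack_stream T G r Qs B) l =
        fold apply_update (query_phase G r Q) (fold apply_update (concat (map (query_phase G r) Qs1)) ?E0)"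
      by (simp add: graph_after_def take public_phase_def)
    also have "\<dots> = (?E0 - query_edge ` {..<G}) \<union> query_edge ` {g. g < G \<and> g div r \<notin> Q}"
      using fold_query_phases[of G r Qs1 ?E0]
      by (simp add: query_phase_def fold_toggles[OF inj_query_edge] lessThan_atLeast0)
    also have "\<dots> = gadget_graph G r B Q"
      unfolding gadget_graph_def by (auto simp: query_edge_neq query_edge_neq[symmetric])
    finally show ?thesis .
  qed
  moreover have "l = Suc (l - 1)" "l - 1 < T" using lT by auto
  ultimately show ?thesis by metis
qed

text \<open>The reference stream, for the empty set, inserts all private edges; the stream of
  \<open>B\<close> has \<open>Bot\<close> at the \<open>r\<close> gadgets of each bit in
  \<open>B\<close>. This is the form that \<open>group_privacy\<close> requires.\<close>

lemma attack_stream_differences: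
  assumes T: "3 * (m * r) + length Qs * (m * r) \<le> T" and r: "1 \<le> r" and B: "B \<subseteq> {..<m}"
  shows "card {i. i < T \<and> attack_stream T (m * r) r Qs B ! i \<noteq> attack_stream T (m * r) r Qs {} ! i}
      = r * card B"
    and "attack_stream T (m * r) r Qs B ! i \<noteq> attack_stream T (m * r) r Qs {} ! i
      \<Longrightarrow> attack_stream T (m * r) r Qs B ! i = Bot"
proof -
  have nth: "attack_stream T (m * r) r Qs B ! i = (if i < m * r \<and> i div r \<in> B then Bot
      else attack_stream T (m * r) r Qs {} ! i)" for i
    by (auto simp: attack_stream_def nth_append length_load_phase) (auto simp: load_phase_def)
  have ref: "attack_stream T (m * r) r Qs {} ! i \<noteq> Bot" if "i < m * r" for i
    using that by (auto simp: attack_stream_def nth_append length_load_phase) (auto simp: load_phase_def)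
  show "attack_stream T (m * r) r Qs B ! i \<noteq> attack_stream T (m * r) r Qs {} ! i
      \<Longrightarrow> attack_stream T (m * r) r Qs B ! i = Bot"
    by (subst nth) (auto simp: nth split: if_splits)
  have "{i. i < T \<and> attack_stream T (m * r) r Qs B ! i \<noteq> attack_stream T (m * r) r Qs {} ! i} =
      {g. g < m * r \<and> g div r \<in> B}"
    using T ref nth by (auto split: if_splits) metis+
  then show "card {i. i < T \<and> attack_stream T (m * r) r Qs B ! i \<noteq> attack_stream T (m * r) r Qs {} ! i}
      = r * card B"
    using card_div_mem[OF r B] by simp
qed

section \<open>The lower bound\<close>

lemma restricted_streams_subset: "restricted_streams V T \<subseteq> dyn_streams V T"
  by (auto simp: restricted_streams_def)

text \<open>Repeating each bit \<open>r\<close> times scales every count difference by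
  \<open>r\<close>, while \<open>\<epsilon> * r \<le> 1\<close> keeps the privacy loss per bit at
  most \<open>exp 1\<close>.\<close>

lemma attack_lower_bound:
  fixes \<epsilon> \<zeta> :: real and r k n T :: nat
  assumes r: "1 \<le> r" "\<epsilon> * r \<le> 1" and n: "4 * (2 ^ k * r) \<le> n" and T: "5 * ((2 ^ k)\<^sup>2 * r) \<le> T"
    and mech: "continual_release_mechanism {..<n} T A" and DP: "edge_DP \<epsilon> {..<n} T A"
    and acc: "accurate_CC_on (restricted_streams {..<n} T) \<zeta> {..<n} T A"
  shows "r * sqrt (2 ^ k) \<le> 16 * \<zeta>"
proof (rule ccontr)
  define m :: nat where "m = 2 ^ k"
  have m: "1 \<le> m" by (simp add: m_def)
  assume "\<not> ?thesis"
  then have small: "16 * \<zeta> < r * sqrt m" by (simp add: m_def)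
  obtain Qs where Qs: "length Qs = 2 * m"
    "\<And>z :: nat \<Rightarrow> real. \<exists>Q\<in>set Qs. Q \<subseteq> {..<m} \<and> (\<Sum>i<m. (z i)\<^sup>2) \<le> 4 * (\<Sum>i\<in>Q. z i)\<^sup>2"
    using distinguishing_queries_exist[of k] unfolding m_def by blast
  define G where "G = m * r"
  have "1 \<le> G" "4 * G \<le> n" using m r n by (auto simp: G_def m_def)
  then have G: "1 \<le> G" "4 * G \<le> n" "1 \<le> n" by auto
  \<comment> \<open>There are \<open>2 * m\<close> query phases of length \<open>G\<close>, and
    \<open>3 * G \<le> 3 * (m * G)\<close>; hence the 5 in the time budget.\<close>
  have "3 * G + length Qs * G \<le> 5 * (m * G)" using Qs m by (simp add: algebra_simps)
  then have TG: "3 * G + length Qs * G \<le> T"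
    using T by (simp add: G_def m_def power2_eq_square algebra_simps)
  define S where "S B = attack_stream T G r Qs B" for B
  have S: "S B \<in> restricted_streams {..<n} T" "S B \<in> dyn_streams {..<n} T" for B
    using attack_stream_in_restricted_streams[OF G(2,3) TG]
      subsetD[OF restricted_streams_subset[of "{..<n}" T]] by (auto simp: S_def)
  define Ev where "Ev B = accurate_outputs {..<n} T \<zeta> (S B)" for B
  have sets: "sets (A (S B)) = sets (output_space T)" "prob_space (A (S B))" for B
    using mech S(2) by (auto simp: continual_release_mechanism_def)
  interpret prob_space "A (S {})" by (rule sets)
  show False
  proof (rule not_clustered_subset_events[OF m r(2)])
    fix B assume B: "B \<subseteq> {..<m}"
    show "Ev B \<in> events" using sets accurate_outputs_measurable by (auto simp: Ev_def)
    have "0.99 \<le> measure (A (S B)) (Ev B)"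
      unfolding Ev_def by (rule measure_accurate_outputs[OF mech acc S])
    also have "\<dots> \<le> exp (\<epsilon> * card {i. i < T \<and> S B ! i \<noteq> S {} ! i}) * prob (Ev B)"
    proof (rule group_privacy[OF DP _ S(2) S(2)])
      show "Ev B \<in> sets (output_space T)" unfolding Ev_def by (rule accurate_outputs_measurable)
      show "S B ! i = Bot \<or> S {} ! i = Bot" if "S B ! i \<noteq> S {} ! i" for i
        using attack_stream_differences(2)[OF TG[unfolded G_def] r(1) B] that
        unfolding S_def G_def by blast
    qed
    also have "card {i. i < T \<and> S B ! i \<noteq> S {} ! i} = r * card B"
      unfolding S_def G_def by (rule attack_stream_differences(1)[OF TG[unfolded G_def] r(1) B])
    finally show "0.99 \<le> exp (\<epsilon> * real r * real (card B)) * prob (Ev B)"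
      by (simp add: mult.assoc)
  next
    fix B B' y assume B: "B \<subseteq> {..<m}" "B' \<subseteq> {..<m}" and y: "y \<in> Ev B" "y \<in> Ev B'"
    \<comment> \<open>Its squared norm is the Hamming distance of \<open>B\<close> and
      \<open>B'\<close>, and its sum over \<open>Q\<close> is the difference of the two query
      answers.\<close>
    define z :: "nat \<Rightarrow> real" where "z i = of_bool (i \<in> B) - of_bool (i \<in> B')" for i
    obtain Q where Q: "Q \<in> set Qs" "Q \<subseteq> {..<m}" "(\<Sum>i<m. (z i)\<^sup>2) \<le> 4 * (\<Sum>i\<in>Q. z i)\<^sup>2"
      using Qs(2) by blast
    obtain t where t: "t < T" "\<And>B. graph_after (S B) (Suc t) = gadget_graph G r B Q"
      using attack_stream_answers_query[OF Q(1) G(1) TG, of r] unfolding S_def by blast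
    define c where "c = card {v. v < n \<and> (4 * G \<le> v \<or> v mod 4 = 0)}"
    have cnt: "num_components {..<n} (graph_after (S B) (Suc t)) = c + r * card (B \<inter> Q)" for B
    proof -
      have "B \<inter> Q \<subseteq> {..<m}" using Q by auto
      from card_div_mem[OF r(1) this] show ?thesis
        unfolding t num_components_gadget_graph[OF G(2)] c_def by (simp add: G_def)
    qed
    have finQ: "finite Q" using Q(2) finite_subset by blast
    have dist: "\<bar>y t - (real c + r * card (B \<inter> Q))\<bar> \<le> \<zeta>" "\<bar>y t - (real c + r * card (B' \<inter> Q))\<bar> \<le> \<zeta>"
      using y t(1) cnt[of B] cnt[of B'] unfolding Ev_def accurate_outputs_def by force+
    have sumQ: "(\<Sum>i\<in>Q. z i) = real (card (B \<inter> Q)) - real (card (B' \<inter> Q))"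
      using finQ by (simp add: z_def sum_subtractf Int_commute flip: of_nat_sum)
    have card_eq: "(\<Sum>i<m. of_bool (i \<in> D)) = real (card ({..<m} \<inter> D))" for D
      by (simp flip: of_nat_sum)
    have "(\<Sum>i<m. (z i)\<^sup>2) = (\<Sum>i<m. of_bool (i \<in> sym_diff B B'))"
      by (intro sum.cong) (auto simp: z_def)
    also have "\<dots> = card ({..<m} \<inter> sym_diff B B')" by (rule card_eq)
    also have "{..<m} \<inter> sym_diff B B' = sym_diff B B'" using B by auto
    finally have sumz: "(\<Sum>i<m. (z i)\<^sup>2) = card (sym_diff B B')" .
    \<comment> \<open>Both true counts lie within \<open>\<zeta>\<close> of the same output
      \<open>y t\<close>.\<close>
    have "\<bar>r * (\<Sum>i\<in>Q. z i)\<bar> \<le> 2 * \<zeta>"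
      unfolding sumQ right_diff_distrib using dist unfolding of_nat_mult by linarith
    then have "(r * (\<Sum>i\<in>Q. z i))\<^sup>2 \<le> (2 * \<zeta>)\<^sup>2" using power_mono[OF _ abs_ge_zero, of _ _ 2] by fastforce
    then have "(real r)\<^sup>2 * (64 * (\<Sum>i\<in>Q. z i)\<^sup>2) \<le> (16 * \<zeta>)\<^sup>2" by (simp add: power_mult_distrib)
    \<comment> \<open>Squaring needs \<open>0 \<le> \<zeta>\<close>, which follows from
      \<open>dist\<close>.\<close>
    moreover have "(16 * \<zeta>)\<^sup>2 < (r * sqrt m)\<^sup>2"
      using small dist by (intro power_strict_mono) auto
    moreover have "(real r)\<^sup>2 * (16 * card (sym_diff B B')) \<le> (real r)\<^sup>2 * (64 * (\<Sum>i\<in>Q. z i)\<^sup>2)"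
      using Q(3) sumz by (intro mult_left_mono) auto
    ultimately have "(real r)\<^sup>2 * (16 * card (sym_diff B B')) < (real r)\<^sup>2 * m"
      by (simp add: power_mult_distrib)
    then have "real (16 * card (sym_diff B B')) < m" using r(1) by simp
    then show "16 * card (sym_diff B B') \<le> m" by linarith
  qed
qed

text \<open>Covers \<open>n\<close> or \<open>T\<close> too small for the attack. Inserting one edge
  first, or not, gives counts \<open>n - 1\<close> and \<open>n\<close>, whose accurate outputs are
  disjoint if \<open>\<zeta> < 1/2\<close>. As \<open>exp \<epsilon> \<le> 3\<close>, one law would
  give these two events at least 0.99 and 0.33.\<close>

lemma error_at_least_half:
  fixes \<epsilon> \<zeta> :: real and n T :: nat
  assumes \<epsilon>: "\<epsilon> < 1" and n: "2 \<le> n" and T: "1 \<le> T"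
    and mech: "continual_release_mechanism {..<n} T A" and DP: "edge_DP \<epsilon> {..<n} T A"
    and acc: "accurate_CC_on (restricted_streams {..<n} T) \<zeta> {..<n} T A"
  shows "1 / 2 \<le> \<zeta>"
proof (rule ccontr)
  assume small: "\<not> 1 / 2 \<le> \<zeta>"
  define e :: "nat set" where "e = {0, 1}"
  define S where "S u = u # replicate (T - 1) Bot" for u :: "nat update"
  have e: "e \<in> all_edges {..<n}" using n by (force simp: e_def all_edges_def)
  have S: "S u \<in> restricted_streams {..<n} T" "S u \<in> dyn_streams {..<n} T" if "u \<in> {Bot, Ins e}" for u
  proof -
    show dyn: "S u \<in> dyn_streams {..<n} T"
      using that e T by (auto simp: S_def dyn_streams_def updates_def)
    show "S u \<in> restricted_streams {..<n} T"
    proof (rule restricted_streamsI[OF dyn])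
      show "matching {e}" "matching {}" by (auto simp: matching_def)
      show "{e. Ins e \<in> set (S u)} \<subseteq> {e} \<union> {}" using that by (auto simp: S_def)
      show "{0} \<union> {1..<n} = {..<n}" "{0} \<inter> {1..<n} = {}" using n by auto
      show "\<exists>u\<in>{0}. \<exists>v\<in>{1..<n}. e' = {u, v}" if "e' \<in> {e} \<union> {}" for e'
        using that n unfolding e_def by (intro bexI[of _ 0] bexI[of _ 1]) simp_all
    qed (use n in \<open>auto simp: lessThan_empty_iff\<close>)
  qed
  have "num_components {..<n} (graph_after (S Bot) (Suc 0)) = card (id ` {..<n})"
    by (intro num_components_eq_card_image) (auto simp: S_def graph_after_def)
  then have c0: "num_components {..<n} (graph_after (S Bot) (Suc 0)) = n" by simp
  let ?f = "\<lambda>v::nat. if v = 1 then 0 else v"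
  have "num_components {..<n} (graph_after (S (Ins e)) (Suc 0)) = card (?f ` {..<n})"
    by (intro num_components_eq_card_image)
      (auto simp: S_def graph_after_def e_def adj_rel_def doubleton_eq_iff insert_commute)
  also have "?f ` {..<n} = {..<n} - {1}" using n by (auto simp: image_iff)
  also have "card \<dots> = n - 1" using n by simp
  finally have c1: "num_components {..<n} (graph_after (S (Ins e)) (Suc 0)) = n - 1" .
  let ?Y = "\<lambda>u. accurate_outputs {..<n} T \<zeta> (S u)"
  have disj: "?Y Bot \<inter> ?Y (Ins e) = {}"
  proof (rule ccontr)
    assume "?Y Bot \<inter> ?Y (Ins e) \<noteq> {}"
    then obtain y where y: "y \<in> ?Y Bot" "y \<in> ?Y (Ins e)" by blast
    have "\<bar>y 0 - real n\<bar> \<le> \<zeta>" "\<bar>y 0 - real (n - 1)\<bar> \<le> \<zeta>"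
      using y T c0 c1 by (auto simp: accurate_outputs_def dest!: spec[of _ 0])
    then show False using small n by (simp add: of_nat_diff)
  qed
  interpret prob_space "A (S Bot)" using mech S by (auto simp: continual_release_mechanism_def)
  have ev: "?Y u \<in> events" for u
    using mech S(2)[of Bot] accurate_outputs_measurable by (auto simp: continual_release_mechanism_def)
  have "edge_neighboring (S (Ins e)) (S Bot)"
    unfolding edge_neighboring_def S_def by (auto intro!: exI[of _ 0] simp: nth_Cons')
  then have "measure (A (S (Ins e))) (?Y (Ins e)) \<le> exp \<epsilon> * prob (?Y (Ins e))"
    using DP[unfolded edge_DP_def, rule_format, of "S (Ins e)" "S Bot"] S(2)[of Bot] S(2)[of "Ins e"]
      accurate_outputs_measurable[of "{..<n}" T \<zeta> "S (Ins e)"] by auto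
  moreover have "0.99 \<le> measure (A (S (Ins e))) (?Y (Ins e))" "0.99 \<le> prob (?Y Bot)"
    by (intro measure_accurate_outputs[OF mech acc] S; simp)+
  moreover have "prob (?Y Bot) + prob (?Y (Ins e)) \<le> 1"
    using finite_measure_Union[OF ev ev disj] prob_le_1 by metis
  moreover have "exp \<epsilon> * prob (?Y (Ins e)) \<le> 3 * prob (?Y (Ins e))"
    using \<epsilon> e_less_272 by (intro mult_right_mono) (auto intro: order_trans[of _ "exp 1"])
  ultimately show False by simp
qed

section \<open>Choice of parameters and conclusion\<close>

lemma CC_error_bound_le:
  shows "CC_error_bound \<epsilon> n T \<le> sqrt (n / \<epsilon>)" "CC_error_bound \<epsilon> n T \<le> T powr (1/4) / \<epsilon> powr (3/4)"
    "CC_error_bound \<epsilon> n T \<le> n" "CC_error_bound \<epsilon> n T \<le> T"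
  unfolding CC_error_bound_def by (rule Min_le; simp)+

text \<open>Take \<open>r\<close> as large as privacy and the budgets permit, then \<open>k\<close>
  maximal. If \<open>n\<close> or \<open>T\<close> limits \<open>r\<close>, then \<open>r\<close>
  alone matches the bound; otherwise \<open>r\<close> is of order \<open>1 / \<epsilon>\<close>, and
  maximality of \<open>k\<close> gives one of the two root terms.\<close>

lemma attack_parameters_exist:
  fixes \<epsilon> :: real and n T :: nat
  assumes \<epsilon>: "0 < \<epsilon>" "\<epsilon> < 1" and n: "4 \<le> n" and T: "5 \<le> T"
  shows "\<exists>r k. 1 \<le> r \<and> \<epsilon> * real r \<le> 1 \<and> 4 * (2 ^ k * r) \<le> n \<and> 5 * ((2 ^ k)\<^sup>2 * r) \<le> T \<and>
    CC_error_bound \<epsilon> n T \<le> 10 * (r * sqrt (2 ^ k))"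
proof -
  define L where "L = min (min (n / 4) (T / 5)) (1 / \<epsilon>)"
  define r where "r = nat \<lfloor>L\<rfloor>"
  have L: "1 \<le> L" "L \<le> n / 4" "L \<le> T / 5" "L \<le> 1 / \<epsilon>" using \<epsilon> n T by (auto simp: L_def)
  have r: "1 \<le> r" "real r \<le> L" "L < real r + 1" using L by (auto simp: r_def le_nat_iff)
  define P where "P k \<longleftrightarrow> 4 * (2 ^ k * r) \<le> n \<and> 5 * ((2 ^ k)\<^sup>2 * r) \<le> T" for k :: nat
  have P0: "P 0" using r L by (auto simp: P_def)
  have bounded: "k \<le> n" if "P k" for k
  proof -
    have "k \<le> 2 ^ k * 1" by (simp add: less_imp_le)
    also have "\<dots> \<le> 2 ^ k * r" using r by (intro mult_left_mono) auto
    finally show ?thesis using that by (auto simp: P_def)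
  qed
  define k where "k = (GREATEST k. P k)"
  have Pk: "P k" unfolding k_def by (rule GreatestI_nat[of P 0 n]) (use P0 bounded in auto)
  have "\<not> P (Suc k)" using Greatest_le_nat[of P "Suc k" n] bounded unfolding k_def by fastforce
  define m :: nat where "m = 2 ^ k"
  have m: "1 \<le> m" by (simp add: m_def)
  \<comment> \<open>Passing to \<open>k + 1\<close> doubles the vertex demand and quadruples the
    time demand, turning 4 into 8 and 5 into 20.\<close>
  have big: "n < 8 * (m * r) \<or> T < 20 * (m\<^sup>2 * r)"
    using \<open>\<not> P (Suc k)\<close> by (auto simp: P_def m_def power_mult_distrib algebra_simps)
  have r_le: "real r \<le> r * sqrt m" using m r by simp
  have L2: "L \<le> 2 * real r" using r by linarith
  consider "L = n / 4" | "L = T / 5" | "L = 1 / \<epsilon>" unfolding L_def min_def by argo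
  then have "CC_error_bound \<epsilon> n T \<le> 10 * (r * sqrt m)"
  proof cases
    case 1
    then show ?thesis using CC_error_bound_le(3)[of \<epsilon> n T] L2 r_le by linarith
  next
    case 2
    \<comment> \<open>This case dictates the constant 10:
      \<open>T = 5 * L \<le> 10 * r\<close>.\<close>
    then show ?thesis using CC_error_bound_le(4)[of \<epsilon> n T] L2 r_le by linarith
  next
    case 3
    have inv: "1 / \<epsilon> \<le> 2 * real r" using L2 3 by simp
    from big show ?thesis
    proof
      assume "n < 8 * (m * r)"
      then have "real n \<le> 8 * (real m * r)" by (metis less_imp_le of_nat_le_iff of_nat_mult of_nat_numeral)
      then have "real n * (1 / \<epsilon>) \<le> (8 * (real m * r)) * (2 * r)"
        using inv \<epsilon> by (intro mult_mono) auto
      also have "\<dots> = (4 * (r * sqrt m))\<^sup>2" by (simp add: power2_eq_square algebra_simps)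
      finally have "sqrt (n / \<epsilon>) \<le> 4 * (r * sqrt m)" by (intro real_le_lsqrt) auto
      then show ?thesis using CC_error_bound_le(1)[of \<epsilon> n T] r_le by linarith
    next
      assume "T < 20 * (m\<^sup>2 * r)"
      then have "real T \<le> 20 * ((real m)\<^sup>2 * r)"
        by (metis less_imp_le of_nat_le_iff of_nat_mult of_nat_numeral of_nat_power)
      moreover have "(1 / \<epsilon>) ^ 3 \<le> (2 * real r) ^ 3" using inv \<epsilon> by (intro power_mono) auto
      ultimately have "real T * (1 / \<epsilon>) ^ 3 \<le> (20 * ((real m)\<^sup>2 * r)) * (2 * r) ^ 3"
        using \<epsilon> by (intro mult_mono) auto
      also have "\<dots> = 160 * (real m)\<^sup>2 * r ^ 4" by (simp add: eval_nat_numeral)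
      \<comment> \<open>160 is rounded up to the fourth power of 4.\<close>
      also have "\<dots> \<le> 256 * (real m)\<^sup>2 * r ^ 4" by (intro mult_right_mono) auto
      also have "\<dots> = (4 * (r * sqrt m)) ^ 4"
      proof -
        have "sqrt m ^ 4 = (real m)\<^sup>2" using power_mult[of "sqrt m" 2 2] by simp
        then show ?thesis by (simp add: power_mult_distrib)
      qed
      finally have *: "real T * (1 / \<epsilon>) ^ 3 \<le> (4 * (r * sqrt m)) ^ 4" .
      have four: "(T powr (1/4) / \<epsilon> powr (3/4)) ^ 4 = real T * (1 / \<epsilon>) ^ 3"
        using \<epsilon> T by (simp add: power_divide powr_power powr_numeral)
      have "T powr (1/4) / \<epsilon> powr (3/4) \<le> 4 * (r * sqrt m)"
      proof (rule power_le_imp_le_base[where n = 3])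
        have "Suc 3 = 4" by simp
        then show "(T powr (1/4) / \<epsilon> powr (3/4)) ^ Suc 3 \<le> (4 * (r * sqrt m)) ^ Suc 3"
          using * by (simp only: four)
      qed simp
      then show ?thesis using CC_error_bound_le(2)[of \<epsilon> n T] r_le by linarith
    qed
  qed
  moreover have "real r \<le> 1 / \<epsilon>" using r L by linarith
  then have "\<epsilon> * real r \<le> 1" using \<epsilon> by (simp add: field_simps)
  ultimately show ?thesis using r Pk unfolding P_def m_def by (intro exI[of _ r] exI[of _ k]) simp
qed

lemma CC_error_lower_bound:
  assumes \<epsilon>: "0 < \<epsilon>" "\<epsilon> < 1" and n: "2 \<le> n" and T: "1 \<le> T"
    and A: "continual_release_mechanism {..<n} T A" "edge_DP \<epsilon> {..<n} T A"
      "accurate_CC_on (restricted_streams {..<n} T) \<zeta> {..<n} T A"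
  shows "1 / 160 * CC_error_bound \<epsilon> n T \<le> \<zeta>"
proof (cases "4 \<le> n \<and> 5 \<le> T")
  case True
  then obtain r k where "1 \<le> r" "\<epsilon> * real r \<le> 1" "4 * (2 ^ k * r) \<le> n" "5 * ((2 ^ k)\<^sup>2 * r) \<le> T"
    and le: "CC_error_bound \<epsilon> n T \<le> 10 * (r * sqrt (2 ^ k))"
    using attack_parameters_exist[OF \<epsilon>, of n T] by blast
  then have "r * sqrt (2 ^ k) \<le> 16 * \<zeta>" by (intro attack_lower_bound[OF _ _ _ _ A])
  then show ?thesis using le by simp
next
  case False
  \<comment> \<open>With \<open>n\<close> or \<open>T\<close> this small, the constant error bound
    suffices because \<open>5 / 160 \<le> 1 / 2\<close>; the 160 itself is \<open>10 * 16\<close>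
    from the main case.\<close>
  then have "CC_error_bound \<epsilon> n T \<le> 5"
    using CC_error_bound_le(3,4)[of \<epsilon> n T] by linarith
  then show ?thesis using error_at_least_half[OF \<epsilon>(2) n T A] by simp
qed

theorem theorem8p8:
  shows
    "(\<exists>c>0. \<forall>(\<epsilon>::real) (n::nat) (T::nat) (A :: nat update list \<Rightarrow> (nat \<Rightarrow> real) measure) (\<zeta>::real).
        0 < \<epsilon> \<and> \<epsilon> < 1 \<and> 2 \<le> n \<and> 1 \<le> T \<and>
        continual_release_mechanism {..<n} T A \<and> edge_DP \<epsilon> {..<n} T A \<and>
        accurate_CC_on (dyn_streams {..<n} T) \<zeta> {..<n} T A
        \<longrightarrow> \<zeta> \<ge> c * CC_error_bound \<epsilon> n T) \<and>
     (\<exists>c>0. \<forall>(\<epsilon>::real) (n::nat) (T::nat) (A :: nat update list \<Rightarrow> (nat \<Rightarrow> real) measure) (\<zeta>::real).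
        0 < \<epsilon> \<and> \<epsilon> < 1 \<and> 2 \<le> n \<and> 1 \<le> T \<and>
        continual_release_mechanism {..<n} T A \<and> edge_DP \<epsilon> {..<n} T A \<and>
        accurate_CC_on (restricted_streams {..<n} T) \<zeta> {..<n} T A
        \<longrightarrow> \<zeta> \<ge> c * CC_error_bound \<epsilon> n T)"
proof -
  \<comment> \<open>Accuracy on all streams is the stronger assumption, so both claims follow from
    the restricted bound with the same constant.\<close>
  have "accurate_CC_on (restricted_streams V T) \<zeta> V T A" if "accurate_CC_on (dyn_streams V T) \<zeta> V T A"
    for V :: "nat set" and T \<zeta> A
    using that restricted_streams_subset unfolding accurate_CC_on_def by blast
  then show ?thesis
    using CC_error_lower_bound by (intro conjI exI[of _ "1 / 160"]) auto
qed

end
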